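(* Let $d\ge1$, and let $\mu$ be a random measure in $\mathcal{P}([0,1]^d)$ with the distribution $\mathbb{P}$ described in the context. Let $E\subset[0,1]^d$ be a Borel set. Then the expectation satisfies $$\mathbb{E}[\mu(E)]=m(E),$$ where $m$ denotes $d$-dimensional Lebesgue measure.
   Context: $\mathcal{P}([0,1]^d)$ is the space of Borel probability measures on $[0,1]^d$, with the weak$^*$ topology. Dyadic cubes. Put $n=2^d$, $\Lambda=\{1,\dots,n\}$, $\Omega=\bigcup_{k\ge 0}\Lambda^k$ (finite words, including the empty word $\emptyset$; $|\omega|$ is the length of $\omega$). Words index the dyadic subcubes $Q_\omega$ of $[0,1]^d$: $Q_\emptyset=[0,1]^d$, and $Q_{\omega 1},\dots,Q_{\omega n}$ are the $2^d$ dyadic cubes of side length $2^{-|\omega|-1}$ partitioning $Q_\omega$ (products of half-open intervals $[a,b)$, closed on the right when $b=1$). Distribution $\mathbb{P}$. Let $X^\omega=(X^\omega_1,\dots,X^\omega_n)$, $\omega\in\Omega$, be independent random vectors, each uniformly distributed on the simplex $\{(x_1,\dots,x_n): x_i\ge 0,\ \sum_i x_i=1\}$. Almost surely this determines a unique random measure $\mu\in\mathcal{P}([0,1]^d)$ with $\mu(Q_{\omega_1\cdots\omega_k})=\prod_{j=1}^k X^{\omega_1\cdots\omega_{j-1}}_{\omega_j}$ for all words. $\mathbb{P}$ is the law of $\mu$, and $\mathbb{E}$ is expectation with respect to $\mathbb{P}$. *)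

theory Defs
  imports "HOL-Probability.Probability"
begin

abbreviation unit_cube :: "(real ^ 'd) set" where
  "unit_cube \<equiv> cbox 0 1"

text \<open>Borel probability measures on the unit cube, as measures whose underlying space is the
  cube itself, with the weak-star topology (as functionals on the continuous functions on the
  cube) and the Borel sigma-algebra of that topology.\<close>

definition cube_probs :: "(real ^ 'd) measure set" where
  "cube_probs = {\<nu>. prob_space \<nu> \<and> sets \<nu> = sets (restrict_space borel unit_cube)}"

definition weak_star :: "(real ^ 'd) measure topology" where
  "weak_star = topology_generated_by
     {{\<nu> \<in> cube_probs. (LINT x|\<nu>. f x) \<in> U} | f U.
        continuous_on unit_cube (f :: real ^ 'd \<Rightarrow> real) \<and> open U}"

definition weak_star_borel :: "(real ^ 'd) measure measure" where
  "weak_star_borel = sigma (topspace weak_star) {U. openin weak_star U}"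

definition dyadic_interval :: "nat \<Rightarrow> nat \<Rightarrow> real set" where
  "dyadic_interval k j =
     (if j + 1 = 2 ^ k then {real j / 2 ^ k .. 1}
      else {real j / 2 ^ k ..< real (j + 1) / 2 ^ k})"

definition dyadic_cube :: "nat \<Rightarrow> (real ^ 'd) set \<Rightarrow> bool" where
  "dyadic_cube k C \<longleftrightarrow>
     (\<exists>j :: 'd \<Rightarrow> nat. (\<forall>i. j i < 2 ^ k) \<and> C = {x. \<forall>i. x $ i \<in> dyadic_interval k (j i)})"

definition words :: "nat \<Rightarrow> nat list set" where
  "words n = lists {1..n}"

text \<open>The order in which the children of a cube are numbered is left arbitrary, and may depend
  on the cube.\<close>

definition dyadic_indexing :: "(nat list \<Rightarrow> (real ^ 'd) set) \<Rightarrow> bool" where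
  "dyadic_indexing Q \<longleftrightarrow>
     Q [] = unit_cube \<and>
     (\<forall>w \<in> words (2 ^ CARD('d)).
        bij_betw (\<lambda>i. Q (w @ [i])) {1 .. 2 ^ CARD('d)}
          {C. dyadic_cube (Suc (length w)) C \<and> C \<subseteq> Q w})"

text \<open>Normalised \<open>n - 1\<close> dimensional Lebesgue measure on the standard simplex in dimension \<open>n\<close>,
  in the coordinates \<open>x\<^sub>1, \<dots>, x\<^sub>n\<^sub>-\<^sub>1\<close>: forgetting the last coordinate is an affine bijection of
  the hyperplane \<open>\<Sum>x\<^sub>i = 1\<close>, so it changes surface measure only by a constant factor. Vectors are
  extensional functions on \<open>{1..n}\<close>.\<close>

definition uniform_simplex :: "nat \<Rightarrow> (nat \<Rightarrow> real) measure" where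
  "uniform_simplex n =
     distr
       (uniform_measure (\<Pi>\<^sub>M i\<in>{1..<n}. lborel)
          {y \<in> space (\<Pi>\<^sub>M i\<in>{1..<n}. lborel). (\<forall>i\<in>{1..<n}. 0 \<le> y i) \<and> (\<Sum>i\<in>{1..<n}. y i) \<le> 1})
       (\<Pi>\<^sub>M i\<in>{1..n}. borel)
       (\<lambda>y. \<lambda>i\<in>{1..n}. if i < n then y i else 1 - (\<Sum>k\<in>{1..<n}. y k))"

text \<open>\<open>X w\<close> is the random vector attached to the word \<open>w\<close>, and \<open>\<mu>\<close> is the random measure that
  the family \<open>X\<close> determines almost surely. The law \<open>\<P>\<close> is
  \<open>distr M weak_star_borel \<mu>\<close>.\<close>

definition dyadic_cascade ::
    "'a measure \<Rightarrow> (nat list \<Rightarrow> (real ^ 'd) set) \<Rightarrow> (nat list \<Rightarrow> 'a \<Rightarrow> nat \<Rightarrow> real)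
       \<Rightarrow> ('a \<Rightarrow> (real ^ 'd) measure) \<Rightarrow> bool" where
  "dyadic_cascade M Q X \<mu> \<longleftrightarrow>
     prob_space M \<and>
     dyadic_indexing Q \<and>
     prob_space.indep_vars M (\<lambda>_. \<Pi>\<^sub>M i\<in>{1 .. 2 ^ CARD('d)}. borel) X (words (2 ^ CARD('d))) \<and>
     (\<forall>w \<in> words (2 ^ CARD('d)).
        distr M (\<Pi>\<^sub>M i\<in>{1 .. 2 ^ CARD('d)}. borel) (X w) = uniform_simplex (2 ^ CARD('d))) \<and>
     \<mu> \<in> measurable M weak_star_borel \<and>
     (AE s in M. \<forall>w \<in> words (2 ^ CARD('d)).
        measure (\<mu> s) (Q w) = (\<Prod>j<length w. X (take j w) s (w ! j)))"

end

theory Submission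
  imports Defs
begin

text \<open>Evaluation of a measure at a closed set is a limit of weak-star continuous functionals, so the
  intensity \<open>E \<mapsto> \<E>[\<mu>(E)]\<close> is a measure on the cube (a bind of \<open>\<mu>\<close>). Every coordinate of a uniform
  point of the simplex has mean \<open>1 / n\<close>, so by independence a dyadic cube of level \<open>k\<close> has intensity
  \<open>(1 / n)\<^sup>k\<close>, which is its volume since \<open>n = 2\<^sup>d\<close>. The dyadic cubes together with the empty set
  are stable under intersection and generate the Borel sets of the cube, so the intensity is
  Lebesgue measure.\<close>

subsection \<open>The uniform distribution on the simplex\<close>

text \<open>The index set and the size \<open>t\<close> are kept general because slicing at one
  coordinate yields a simplex in fewer variables and of smaller size. The parameter domain of
  \<open>uniform_simplex n\<close> is the case \<open>A = {1..<n}\<close>,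
  \<open>t = 1\<close>.\<close>

definition std_simplex :: "'i set \<Rightarrow> real \<Rightarrow> ('i \<Rightarrow> real) set" where
  "std_simplex A t = {y \<in> space (\<Pi>\<^sub>M i\<in>A. lborel). (\<forall>i\<in>A. 0 \<le> y i) \<and> (\<Sum>i\<in>A. y i) \<le> t}"

lemma std_simplex_measurable [measurable]:
  assumes "finite A"
  shows "std_simplex A t \<in> sets (\<Pi>\<^sub>M i\<in>A. lborel)"
proof -
  have "std_simplex A t = Pi\<^sub>E A (\<lambda>_. {0..}) \<inter> (\<lambda>x. sum x A) -` {..t} \<inter> space (Pi\<^sub>M A (\<lambda>_. lborel))"
    by (auto simp: std_simplex_def space_PiM)
  also have "\<dots> \<in> sets (Pi\<^sub>M A (\<lambda>_. lborel))"
    using assms by measurable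
  finally show ?thesis .
qed

lemma emeasure_PiM_std_simplex:
  assumes "finite A" "t \<ge> 0"
  shows "emeasure (\<Pi>\<^sub>M i\<in>A. lborel) (std_simplex A t) = ennreal (t ^ card A / fact (card A))"
proof -
  have "std_simplex A t = {x. (\<forall>i\<in>A. 0 \<le> x i) \<and> sum x A \<le> t} \<inter> space (\<Pi>\<^sub>M i\<in>A. lborel)"
    by (auto simp: std_simplex_def)
  then show ?thesis
    using emeasure_std_simplex_aux[OF assms] by simp
qed

text \<open>Fubini form of slicing: once coordinate \<open>b\<close> is split off, the inner
  integral over the other coordinates becomes the volume of a smaller simplex.\<close>

lemma fun_upd_in_std_simplex_iff:
  assumes "b \<notin> A" "finite A" "x \<in> space (\<Pi>\<^sub>M i\<in>A. lborel)"
  shows "x(b := y) \<in> std_simplex (insert b A) t \<longleftrightarrow> y \<in> {0..t} \<and> x \<in> std_simplex A (t - y)"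
proof -
  have "x(b := y) \<in> space (\<Pi>\<^sub>M i\<in>insert b A. lborel)"
    using assms(3) by (auto simp: space_PiM PiE_def extensional_def)
  then show ?thesis
    using emeasure_std_simplex_aux_step[OF assms(1,2), of x y t] assms(3)
    by (auto simp: std_simplex_def)
qed

text \<open>With \<open>b\<close> as the outermost variable and \<open>k\<close> the number of other
  coordinates, the slice at \<open>t\<close> has volume \<open>(1 - t) ^ k / fact k\<close>. What
  remains is the Beta integral of \<open>t * (1 - t) ^ k / fact k\<close> over [0,1], which equals
  \<open>1 / fact (k + 2)\<close>.\<close>

lemma nn_integral_std_simplex_coord:
  assumes "finite A" "b \<in> A"
  shows "(\<integral>\<^sup>+y. ennreal (y b) * indicator (std_simplex A 1) y \<partial>(\<Pi>\<^sub>M i\<in>A. lborel))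
    = ennreal (1 / fact (Suc (card A)))"
proof -
  define B k where "B = A - {b}" and "k = card B"
  have fin [simp]: "finite B" and nb [simp]: "b \<notin> B" and A: "A = insert b B"
    using assms by (auto simp: B_def)
  have card_A: "card A = Suc k"
    by (simp add: A k_def)
  \<comment> \<open>Integration by parts gives the antiderivative \<open>F\<close> of
    \<open>t * (1 - t) ^ k / fact k\<close>, with \<open>p\<close> and \<open>q\<close> as the
    coefficients from integrating \<open>(1 - t) ^ k\<close> once and twice. The identities
    \<open>pq\<close> clear the factors that differentiation produces. Since \<open>F 1 = 0\<close>,
    the integral is \<open>- F 0 = q / fact k\<close>.\<close>
  define p q where "p = 1 / (1 + real k)" and "q = p / (2 + real k)"
  have pq: "p * (1 + real k) = 1" "q * (2 + real k) = p"
    by (simp_all add: p_def q_def)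
  define F where "F t = - (t * (1 - t) ^ Suc k * p + (1 - t) ^ Suc (Suc k) * q) / fact k" for t
  let ?P = "\<lambda>A. \<Pi>\<^sub>M i\<in>A. (lborel :: real measure)"
  interpret product_sigma_finite "\<lambda>_. lborel :: real measure"
    by standard
  have [measurable]: "std_simplex (insert b B) 1 \<in> sets (?P (insert b B))"
    "\<And>t. std_simplex B t \<in> sets (?P B)"
    by (auto intro!: std_simplex_measurable)
  have "(\<integral>\<^sup>+y. ennreal (y b) * indicator (std_simplex A 1) y \<partial>?P A)
      = (\<integral>\<^sup>+t. \<integral>\<^sup>+x. ennreal ((x(b := t)) b) * indicator (std_simplex A 1) (x(b := t)) \<partial>?P B \<partial>lborel)"
    unfolding A by (rule product_nn_integral_insert_rev) auto
  also have "\<dots> = (\<integral>\<^sup>+t. \<integral>\<^sup>+x. ennreal t * indicator {0..1} t * indicator (std_simplex B (1 - t)) x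
      \<partial>?P B \<partial>lborel)"
    unfolding A by (intro nn_integral_cong) (auto simp: indicator_def fun_upd_in_std_simplex_iff)
  also have "\<dots> = (\<integral>\<^sup>+t. ennreal t * indicator {0..1} t * emeasure (?P B) (std_simplex B (1 - t)) \<partial>lborel)"
    by (simp add: nn_integral_cmult)
  also have "\<dots> = (\<integral>\<^sup>+t\<in>{0..1}. ennreal (t * (1 - t) ^ k / fact k) \<partial>lborel)"
    by (intro nn_integral_cong)
      (auto simp: indicator_def emeasure_PiM_std_simplex k_def simp flip: ennreal_mult)
  also have "\<dots> = ennreal (F 1 - F 0)"
  proof (rule nn_integral_FTC_Icc)
    fix t :: real
    have "((\<lambda>t. t * (1 - t) ^ Suc k * p + (1 - t) ^ Suc (Suc k) * q) has_real_derivative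
      (1 - t) ^ Suc k * p - t * (1 - t) ^ k * (p * (1 + real k)) - (1 - t) ^ Suc k * (q * (2 + real k))) (at t)"
      by (rule derivative_eq_intros refl)+ (simp add: algebra_simps)
    then have "((\<lambda>t. t * (1 - t) ^ Suc k * p + (1 - t) ^ Suc (Suc k) * q) has_real_derivative
      - (t * (1 - t) ^ k)) (at t)"
      by (simp add: pq)
    from DERIV_cdivide[OF DERIV_minus[OF this], of "fact k"]
    show "(F has_real_derivative t * (1 - t) ^ k / fact k) (at t)"
      unfolding F_def by simp
  qed auto
  also have "F 1 - F 0 = 1 / fact (Suc (card A))"
    by (simp add: F_def card_A p_def q_def)
  finally show ?thesis .
qed

text \<open>On the simplex the slack and the \<open>m\<close> coordinates add up to 1, so their
  integrals add up to the volume \<open>1 / fact m\<close>. Each coordinate contributes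
  \<open>1 / fact (Suc m)\<close>, which leaves the same amount for the slack.\<close>

lemma nn_integral_std_simplex_slack:
  assumes "finite A"
  shows "(\<integral>\<^sup>+y. ennreal (1 - (\<Sum>i\<in>A. y i)) * indicator (std_simplex A 1) y \<partial>(\<Pi>\<^sub>M i\<in>A. lborel))
    = ennreal (1 / fact (Suc (card A)))" (is "?I = _")
proof -
  let ?P = "\<Pi>\<^sub>M i\<in>A. (lborel :: real measure)" and ?S = "std_simplex A 1"
  have [measurable]: "?S \<in> sets ?P"
    using assms by (rule std_simplex_measurable)
  define m where "m = card A"
  have "?I + (\<Sum>i\<in>A. \<integral>\<^sup>+y. ennreal (y i) * indicator ?S y \<partial>?P)
      = (\<integral>\<^sup>+y. ennreal (1 - (\<Sum>i\<in>A. y i)) * indicator ?S y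
          + (\<Sum>i\<in>A. ennreal (y i) * indicator ?S y) \<partial>?P)"
    using assms by (subst nn_integral_add, measurable, subst nn_integral_sum, measurable)
  also have "\<dots> = (\<integral>\<^sup>+y. indicator ?S y \<partial>?P)"
    by (intro nn_integral_cong)
      (auto simp: indicator_def std_simplex_def sum_nonneg simp flip: ennreal_plus)
  also have "\<dots> = ennreal (1 / fact m)"
    using assms by (simp add: emeasure_PiM_std_simplex m_def)
  finally have "?I + ennreal (real m / fact (Suc m)) = ennreal (1 / fact m)"
    using assms by (simp add: nn_integral_std_simplex_coord m_def ennreal_of_nat_eq_real_of_nat flip: ennreal_mult)
  \<comment> \<open>The volume is split as 1 + \<open>m\<close> equal shares so that the finite term
    \<open>m / fact (Suc m)\<close> can be cancelled in \<open>ennreal\<close> without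
    subtraction.\<close>
  also have "1 / fact m = 1 / fact (Suc m) + real m / fact (Suc m)"
    by (simp add: add_divide_distrib[symmetric] del: of_nat_Suc) (simp add: divide_simps)
  also have "ennreal \<dots> = ennreal (1 / fact (Suc m)) + ennreal (real m / fact (Suc m))"
    by (simp del: fact_Suc)
  finally show ?thesis
    unfolding m_def by (simp add: ennreal_add_left_cancel add.commute[of _ "ennreal (real _ / _)"] del: fact_Suc)
qed

section \<open>Sign and mean of the coordinates of a uniform point of the simplex\<close>

lemma uniform_simplex_altdef:
  "uniform_simplex n = distr
     (uniform_measure (\<Pi>\<^sub>M i\<in>{1..<n}. lborel) (std_simplex {1..<n} 1)) (\<Pi>\<^sub>M i\<in>{1..n}. borel)
     (\<lambda>y. \<lambda>i\<in>{1..n}. if i < n then y i else 1 - (\<Sum>k\<in>{1..<n}. y k))"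
  by (simp add: uniform_simplex_def std_simplex_def)

lemma simplex_parametrization_measurable [measurable]:
  "(\<lambda>y. \<lambda>i\<in>{1..n}. if i < n then y i else 1 - (\<Sum>k\<in>{1..<n}. y k))
    \<in> uniform_measure (\<Pi>\<^sub>M i\<in>{1..<n}. lborel) S \<rightarrow>\<^sub>M (\<Pi>\<^sub>M i\<in>{1..n}. (borel :: real measure))"
proof (rule measurable_restrict)
  fix i assume "i \<in> {1..n}"
  then show "(\<lambda>y. if i < n then y i else 1 - (\<Sum>k\<in>{1..<n}. y k))
    \<in> uniform_measure (\<Pi>\<^sub>M i\<in>{1..<n}. lborel) S \<rightarrow>\<^sub>M borel"
    by (cases "i < n") (auto simp: measurable_cong_sets[OF sets_uniform_measure refl])
qed

lemma AE_uniform_simplex_nonneg: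
  assumes "i \<in> {1..n}"
  shows "AE x in uniform_simplex n. 0 \<le> x i"
proof -
  have [measurable]: "std_simplex {1..<n} 1 \<in> sets (\<Pi>\<^sub>M i\<in>{1..<n}. lborel)"
    by (rule std_simplex_measurable) simp
  have "AE y in uniform_measure (\<Pi>\<^sub>M i\<in>{1..<n}. lborel) (std_simplex {1..<n} 1).
      0 \<le> (\<lambda>i\<in>{1..n}. if i < n then y i else 1 - (\<Sum>k\<in>{1..<n}. y k)) i"
    by (rule AE_uniform_measureI) (use assms in \<open>auto simp: std_simplex_def\<close>)
  then show ?thesis
    unfolding uniform_simplex_altdef using assms by (subst AE_distr_iff) measurable
qed

text \<open>For \<open>i < n\<close> the coordinate is a parameter, for \<open>i = n\<close> it is
  the slack; the integral over the parameter domain is \<open>1 / fact n\<close> in both cases.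
  Dividing by the volume \<open>1 / fact (n - 1)\<close> gives the mean.\<close>

lemma nn_integral_uniform_simplex_coord:
  assumes "i \<in> {1..n}"
  shows "(\<integral>\<^sup>+x. ennreal (x i) \<partial>uniform_simplex n) = ennreal (1 / n)"
proof -
  let ?P = "\<Pi>\<^sub>M i\<in>{1..<n}. (lborel :: real measure)" and ?S = "std_simplex {1..<n} 1"
  let ?f = "\<lambda>y. if i < n then y i else 1 - (\<Sum>k\<in>{1..<n}. y k)"
  have [measurable]: "?S \<in> sets ?P"
    by (rule std_simplex_measurable) simp
  have n: "Suc (n - 1) = n"
    using assms by auto
  have [measurable]: "?f \<in> borel_measurable ?P"
    using assms by (cases "i < n") auto
  have "(\<integral>\<^sup>+x. ennreal (x i) \<partial>uniform_simplex n) = (\<integral>\<^sup>+y. ennreal (?f y) \<partial>uniform_measure ?P ?S)"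
    unfolding uniform_simplex_altdef
    using assms
    by (subst nn_integral_distr[OF simplex_parametrization_measurable])
      (auto intro!: nn_integral_cong)
  also have "\<dots> = (\<integral>\<^sup>+y. ennreal (?f y) * indicator ?S y \<partial>?P) / emeasure ?P ?S"
    by (rule nn_integral_uniform_measure) measurable
  also have "(\<integral>\<^sup>+y. ennreal (?f y) * indicator ?S y \<partial>?P) = ennreal (1 / fact n)"
    using nn_integral_std_simplex_coord[of "{1..<n}" i] nn_integral_std_simplex_slack[of "{1..<n}"]
      assms n by (cases "i < n") (auto simp del: fact_Suc)
  also have "emeasure ?P ?S = ennreal (1 / fact (n - 1))"
    by (simp add: emeasure_PiM_std_simplex)
  also have "ennreal (1 / fact n) / ennreal (1 / fact (n - 1)) = ennreal (1 / n)"
    using fact_Suc[of "n - 1", where ?'a = real] n by (subst divide_ennreal) auto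
  finally show ?thesis .
qed

subsection \<open>The weak-star Borel sigma-algebra\<close>

lemma sets_restrict_space_sigma:
  assumes "sets M = sigma_sets \<Omega> G" "S \<in> sets M" "S \<subseteq> \<Omega>"
  shows "sets (restrict_space M S) = sigma_sets S ((\<inter>) S ` G)"
  using sigma_sets_Int[of S \<Omega> G] assms by (simp add: sets_restrict_space)

lemma sets_borel_eq_closed: "sets borel = sigma_sets UNIV (Collect closed)"
  by (subst borel_eq_closed) simp

lemma topspace_weak_star: "topspace (weak_star :: (real ^ 'd) measure topology) = cube_probs"
proof -
  let ?G = "{{\<nu> \<in> cube_probs. (LINT x|\<nu>. f x) \<in> U} | f U.
        continuous_on unit_cube (f :: real ^ 'd \<Rightarrow> real) \<and> open U}"
  \<comment> \<open>The zero function with target \<open>UNIV\<close> exhibits all of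
    \<open>cube_probs\<close> as a single subbasic set.\<close>
  have "{\<nu> \<in> cube_probs. (LINT x|\<nu>. (0::real)) \<in> UNIV} \<in> ?G"
    by (auto intro!: exI[of _ "\<lambda>_. 0"] exI[of _ UNIV])
  then have "cube_probs \<subseteq> \<Union>?G"
    by auto
  moreover have "\<Union>?G \<subseteq> cube_probs"
    by auto
  ultimately show ?thesis
    unfolding weak_star_def topology_generated_by_topspace by blast
qed

lemma space_weak_star_borel: "space weak_star_borel = cube_probs"
  unfolding weak_star_borel_def
  by (auto simp: space_measure_of_conv topspace_weak_star)

lemma emeasure_eq_measure_weak_star:
  assumes "\<nu> \<in> space weak_star_borel"
  shows "emeasure \<nu> A = ennreal (measure \<nu> A)"
  using assms finite_measure.emeasure_eq_measure[OF prob_space.finite_measure, of \<nu> A]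
  by (simp add: space_weak_star_borel cube_probs_def)

lemma openin_weak_star_measurable:
  assumes "openin weak_star U"
  shows "U \<in> sets weak_star_borel"
  unfolding weak_star_borel_def
  using assms by (subst sets_measure_of) (auto dest: openin_subset)

text \<open>Preimages of open sets under these functionals are subbasic open sets of
  \<open>weak_star\<close>.\<close>

lemma measurable_weak_star_integral:
  fixes f :: "real ^ 'd \<Rightarrow> real"
  assumes "continuous_on unit_cube f"
  shows "(\<lambda>\<nu>. LINT x|\<nu>. f x) \<in> borel_measurable weak_star_borel"
proof (rule borel_measurableI)
  fix U :: "real set"
  assume "open U"
  then have "openin weak_star {\<nu> \<in> cube_probs. (LINT x|\<nu>. f x) \<in> U}"
    unfolding weak_star_def using assms
    by (intro topology_generated_by_Basis) auto
  moreover have "{\<nu> \<in> cube_probs. (LINT x|\<nu>. f x) \<in> U} = (\<lambda>\<nu>. LINT x|\<nu>. f x) -` U \<inter> space weak_star_borel"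
    by (auto simp: space_weak_star_borel)
  ultimately show "(\<lambda>\<nu>. LINT x|\<nu>. f x) -` U \<inter> space weak_star_borel \<in> sets weak_star_borel"
    by (metis openin_weak_star_measurable)
qed

text \<open>The continuous function \<open>h\<close> is 1 on \<open>C\<close> and lies strictly
  between 0 and 1 elsewhere. Its powers therefore decrease to the indicator of \<open>C\<close>, and
  dominated convergence makes the evaluation a pointwise limit of measurable functionals.\<close>

lemma measurable_weak_star_measure_closed:
  fixes C :: "(real ^ 'd) set"
  assumes "closed C"
  shows "(\<lambda>\<nu>. measure \<nu> (C \<inter> unit_cube)) \<in> borel_measurable weak_star_borel"
\<comment> \<open>The empty set is treated apart because \<open>infdist x {}\<close> is 0 by
  convention, which would make \<open>h\<close> constantly 1.\<close>
proof (cases "C = {}")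
  case False
  define h where "h = (\<lambda>x. 1 / (1 + infdist x C))"
  have h: "0 < h x" "h x \<le> 1" "h x = 1 \<longleftrightarrow> x \<in> C" for x
    using infdist_nonneg[of x C] in_closed_iff_infdist_zero[OF assms False, of x]
    by (auto simp: h_def field_simps add_nonneg_eq_0_iff)
  have cont: "continuous_on UNIV h"
    unfolding h_def using infdist_nonneg[of _ C]
    by (auto intro!: continuous_intros simp: add_nonneg_eq_0_iff)
  have [measurable]: "h \<in> borel_measurable borel"
    using cont by (rule borel_measurable_continuous_onI)
  have lim: "(\<lambda>k. LINT x|\<nu>. h x ^ k) \<longlonglongrightarrow> measure \<nu> (C \<inter> unit_cube)"
    if "\<nu> \<in> cube_probs" for \<nu>
  proof -
    interpret prob_space \<nu>
      using that by (simp add: cube_probs_def)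
    have sets [measurable_cong]: "sets \<nu> = sets (restrict_space borel unit_cube)"
      using that by (simp add: cube_probs_def)
    have space: "space \<nu> = unit_cube"
      using sets_eq_imp_space_eq[OF sets] by (simp add: space_restrict_space)
    have [measurable]: "C \<inter> unit_cube \<in> sets \<nu>"
      using assms by (auto simp: sets sets_restrict_space)
    have [measurable]: "h \<in> borel_measurable \<nu>"
      by (simp add: measurable_cong_sets[OF sets refl] measurable_restrict_space1)
    have "(\<lambda>k. LINT x|\<nu>. h x ^ k) \<longlonglongrightarrow> (LINT x|\<nu>. indicator (C \<inter> unit_cube) x)"
    proof (rule integral_dominated_convergence[where w = "\<lambda>_. 1"])
      show "AE x in \<nu>. (\<lambda>k. h x ^ k) \<longlonglongrightarrow> indicator (C \<inter> unit_cube) x"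
      proof (rule AE_I2)
        fix x assume "x \<in> space \<nu>"
        then have x: "x \<in> unit_cube" by (simp add: space)
        show "(\<lambda>k. h x ^ k) \<longlonglongrightarrow> indicator (C \<inter> unit_cube) x"
        proof (cases "x \<in> C")
          case True
          then show ?thesis using h(3)[of x] x by simp
        next
          case False
          then have "h x < 1" using h(2,3)[of x] by linarith
          then show ?thesis
            using False h(1)[of x] by (simp add: LIMSEQ_realpow_zero less_imp_le)
        qed
      qed
      show "AE x in \<nu>. norm (h x ^ k) \<le> 1" for k
        using h by (auto simp: power_le_one less_imp_le abs_of_pos)
    qed auto
    then show ?thesis by simp
  qed
  show ?thesis
  proof (rule borel_measurable_LIMSEQ_real)
    show "(\<lambda>\<nu>. LINT x|\<nu>. h x ^ k) \<in> borel_measurable weak_star_borel" for k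
      by (intro measurable_weak_star_integral continuous_intros continuous_on_subset[OF cont]) auto
  qed (use lim in \<open>auto simp: space_weak_star_borel\<close>)
qed simp

text \<open>This makes a weak-star measurable random measure a probability kernel, so that its
  intensity can be written with \<open>bind\<close>. Traces of closed sets form an
  intersection-stable generator, and measurability of evaluation on them extends to all Borel sets
  of the cube.\<close>

lemma id_measurable_weak_star_borel:
  "id \<in> weak_star_borel \<rightarrow>\<^sub>M prob_algebra (restrict_space borel (unit_cube :: (real ^ 'd) set))"
proof (rule measurable_prob_algebra_generated[OF sets_restrict_space_sigma[OF sets_borel_eq_closed]])
  show "Int_stable ((\<inter>) (unit_cube :: (real ^ 'd) set) ` Collect closed)"
  proof (rule Int_stableI)
    fix A B assume "A \<in> (\<inter>) (unit_cube :: (real ^ 'd) set) ` Collect closed"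
      "B \<in> (\<inter>) (unit_cube :: (real ^ 'd) set) ` Collect closed"
    then obtain C D where "closed C" "closed D" "A = unit_cube \<inter> C" "B = unit_cube \<inter> D"
      by auto
    then show "A \<inter> B \<in> (\<inter>) (unit_cube :: (real ^ 'd) set) ` Collect closed"
      by (intro image_eqI[of _ _ "C \<inter> D"]) auto
  qed
  fix A assume "A \<in> (\<inter>) (unit_cube :: (real ^ 'd) set) ` Collect closed"
  then obtain C where C: "closed C" "A = C \<inter> unit_cube"
    by auto
  have "(\<lambda>\<nu>. ennreal (measure \<nu> A)) \<in> borel_measurable weak_star_borel"
    using measurable_weak_star_measure_closed[OF C(1)] by (simp add: C(2))
  moreover have "emeasure (id \<nu>) A = ennreal (measure \<nu> A)" if "\<nu> \<in> space weak_star_borel" for \<nu>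
    using that by (simp add: emeasure_eq_measure_weak_star)
  ultimately show "(\<lambda>\<nu>. emeasure (id \<nu>) A) \<in> borel_measurable weak_star_borel"
    by (simp cong: measurable_cong)
qed (auto simp: space_weak_star_borel cube_probs_def)

subsection \<open>Dyadic cubes\<close>

text \<open>The number of the dyadic interval of level \<open>k\<close> that contains \<open>x\<close>. The last interval is closed on
  the right, hence the special value at \<open>1\<close>.\<close>

definition dyadic_index :: "nat \<Rightarrow> real \<Rightarrow> nat" where
  "dyadic_index k x = (if x = 1 then 2 ^ k - 1 else nat \<lfloor>2 ^ k * x\<rfloor>)"

lemma nat_floor_eq_iff: "0 \<le> y \<Longrightarrow> nat \<lfloor>y\<rfloor> = j \<longleftrightarrow> real j \<le> y \<and> y < real j + 1" for y :: real
  by (auto simp: nat_eq_iff floor_eq_iff)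

text \<open>Dyadic intervals become the fibres of \<open>dyadic_index k\<close> on [0,1], so
  questions about nesting and overlap reduce to equalities of indices. The point 1 is a case of its
  own because of the closed right end.\<close>

lemma mem_dyadic_interval_iff:
  assumes "j < 2 ^ k"
  shows "x \<in> dyadic_interval k j \<longleftrightarrow> x \<in> {0..1} \<and> dyadic_index k x = j"
proof -
  have j: "real j + 1 \<le> 2 ^ k"
    using assms by (metis Suc_eq_plus1 Suc_leI of_nat_Suc of_nat_le_numeral_power_cancel_iff add.commute)
  have last: "real j + 1 = 2 ^ k \<longleftrightarrow> j + 1 = 2 ^ k"
    by (metis of_nat_1 of_nat_add of_nat_eq_iff of_nat_numeral of_nat_power)
  consider "x < 0" | "x > 1" | "x = 1" | "0 \<le> x" "x < 1"
    by linarith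
  then show ?thesis
  proof cases
    case 1
    then have "2 ^ k * x < real j"
      using mult_pos_neg[of "2 ^ k" x] by (smt (verit) of_nat_0_le_iff zero_less_power)
    then show ?thesis
      using 1 by (auto simp: dyadic_interval_def field_simps)
  next
    case 2
    then have "2 ^ k * x \<ge> real j + 1"
      using j mult_left_mono[of 1 x "2 ^ k"] by linarith
    then show ?thesis
      using 2 by (auto simp: dyadic_interval_def field_simps)
  next
    case 3
    then show ?thesis
      using j last assms by (auto simp: dyadic_interval_def dyadic_index_def field_simps)
  next
    case 4
    then have "2 ^ k * x < 2 ^ k" "0 \<le> 2 ^ k * x"
      by auto
    then show ?thesis
      using 4 last
      by (auto simp: dyadic_interval_def dyadic_index_def nat_floor_eq_iff field_simps)
  qed
qed

lemma dyadic_index_less: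
  assumes "x \<in> {0..1}"
  shows "dyadic_index k x < 2 ^ k"
proof (cases "x = 1")
  case False
  with assms have "0 \<le> 2 ^ k * x" "2 ^ k * x < 2 ^ k"
    by auto
  then have "nat \<lfloor>2 ^ k * x\<rfloor> < 2 ^ k"
    by (simp add: nat_less_iff floor_less_iff)
  with False show ?thesis
    by (simp add: dyadic_index_def)
qed (simp add: dyadic_index_def)

text \<open>Passing to the parent interval halves the index, since the floor of \<open>y / 2\<close>
  is the floor of \<open>y\<close> divided by 2. The special value at 1 fits, as
  \<open>2 ^ Suc k - 1\<close> halves to \<open>2 ^ k - 1\<close>.\<close>

lemma dyadic_index_Suc_div_2:
  assumes "x \<in> {0..1}"
  shows "dyadic_index (Suc k) x div 2 = dyadic_index k x"
proof (cases "x = 1")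
  case False
  have "\<lfloor>2 ^ k * x\<rfloor> = \<lfloor>2 ^ Suc k * x\<rfloor> div 2"
    using floor_divide_real_eq_div[of 2 "2 ^ Suc k * x"] by simp
  then show ?thesis
    using False assms by (simp add: dyadic_index_def nat_div_distrib)
next
  case True
  have "(2 * n - 1) div 2 = n - (1::nat)" for n
    by (cases n) auto
  then show ?thesis
    using True by (simp add: dyadic_index_def)
qed

text \<open>Descending induction from \<open>l\<close> to \<open>k\<close>, where each step passes
  to parents on both sides.\<close>

lemma dyadic_index_mono:
  assumes "x \<in> {0..1}" "y \<in> {0..1}" "dyadic_index l x = dyadic_index l y" "k \<le> l"
  shows "dyadic_index k x = dyadic_index k y"
  using assms(4)
proof (induction rule: inc_induct)
  case (step n)
  then show ?case
    using dyadic_index_Suc_div_2[of x n] dyadic_index_Suc_div_2[of y n] assms(1,2) by simp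
qed (fact assms(3))

text \<open>For \<open>x\<close> in the cube this is the dyadic cube of level \<open>k\<close>
  around \<open>x\<close>. Naming it by a point instead of an integer vector turns the cubes of one
  level into equivalence classes.\<close>

definition dyadic_cell :: "nat \<Rightarrow> real ^ 'd \<Rightarrow> (real ^ 'd) set" where
  "dyadic_cell k x = {y \<in> unit_cube. \<forall>i. dyadic_index k (y $ i) = dyadic_index k (x $ i)}"

lemma mem_unit_cube_iff: "(x :: real ^ 'd) \<in> unit_cube \<longleftrightarrow> (\<forall>i. x $ i \<in> {0..1})"
  by (simp add: mem_box_cart)

lemma dyadic_cell_altdef:
  assumes "(x :: real ^ 'd) \<in> unit_cube"
  shows "dyadic_cell k x = {y. \<forall>i. y $ i \<in> dyadic_interval k (dyadic_index k (x $ i))}"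
proof -
  have "dyadic_index k (x $ i) < 2 ^ k" for i
    using assms by (intro dyadic_index_less) (simp only: mem_unit_cube_iff)
  then have "y $ i \<in> dyadic_interval k (dyadic_index k (x $ i)) \<longleftrightarrow>
      y $ i \<in> {0..1} \<and> dyadic_index k (y $ i) = dyadic_index k (x $ i)" for y :: "real ^ 'd" and i
    by (rule mem_dyadic_interval_iff)
  then show ?thesis
    unfolding dyadic_cell_def mem_unit_cube_iff by blast
qed

lemma dyadic_cube_iff: "dyadic_cube k C \<longleftrightarrow> (\<exists>x \<in> unit_cube. C = dyadic_cell k x)"
proof
  assume "dyadic_cube k C"
  then obtain j where j: "\<And>i. j i < 2 ^ k" and C: "C = {x. \<forall>i. x $ i \<in> dyadic_interval k (j i)}"
    by (auto simp: dyadic_cube_def)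
  \<comment> \<open>The corner with the smallest coordinates serves as representative: left ends
    belong to all dyadic intervals, including the last one.\<close>
  define x :: "real ^ 'a" where "x = (\<chi> i. real (j i) / 2 ^ k)"
  have "x $ i \<in> dyadic_interval k (j i)" for i
  proof -
    have "real (j i) < 2 ^ k"
      using j[of i] by simp
    then show ?thesis
      by (simp add: x_def dyadic_interval_def field_simps)
  qed
  then have x: "x $ i \<in> {0..1} \<and> dyadic_index k (x $ i) = j i" for i
    using mem_dyadic_interval_iff[OF j] by blast
  then have "x \<in> unit_cube"
    by (simp add: mem_unit_cube_iff)
  then show "\<exists>x \<in> unit_cube. C = dyadic_cell k x"
    using x by (intro bexI[of _ x]) (auto simp: dyadic_cell_altdef C)
next
  assume "\<exists>x \<in> unit_cube. C = dyadic_cell k x"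
  then obtain x where x: "x \<in> unit_cube" "C = dyadic_cell k x"
    by auto
  then have "dyadic_index k (x $ i) < 2 ^ k" for i
    by (intro dyadic_index_less) (simp only: mem_unit_cube_iff)
  with x show "dyadic_cube k C"
    unfolding dyadic_cube_def
    by (intro exI[of _ "\<lambda>i. dyadic_index k (x $ i)"]) (simp add: dyadic_cell_altdef)
qed

lemma dyadic_cell_0: "x \<in> unit_cube \<Longrightarrow> dyadic_cell 0 x = unit_cube"
  using dyadic_index_less[of _ 0] by (auto simp: dyadic_cell_def mem_unit_cube_iff)

lemma dyadic_cell_antimono:
  assumes "x \<in> unit_cube" "k \<le> l"
  shows "dyadic_cell l x \<subseteq> dyadic_cell k x"
  using assms unfolding dyadic_cell_def mem_unit_cube_iff
  by (auto intro: dyadic_index_mono simp del: atLeastAtMost_iff)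

lemma dyadic_cell_eqI: "z \<in> dyadic_cell k x \<Longrightarrow> dyadic_cell k x = dyadic_cell k z"
  by (auto simp: dyadic_cell_def)

text \<open>A common point \<open>z\<close> represents both cells, and cells around one point are
  nested, so the intersection is the finer of the two.\<close>

lemma dyadic_cell_Int:
  assumes "x \<in> unit_cube" "z \<in> dyadic_cell k x \<inter> dyadic_cell l y"
  shows "dyadic_cell k x \<inter> dyadic_cell l y = dyadic_cell (max k l) z"
proof -
  have "z \<in> unit_cube" "dyadic_cell k x = dyadic_cell k z" "dyadic_cell l y = dyadic_cell l z"
    using assms dyadic_cell_eqI by (auto simp: dyadic_cell_def)
  then show ?thesis
    using dyadic_cell_antimono[of z k "max k l"] dyadic_cell_antimono[of z l "max k l"]
    by (auto simp: max_def)
qed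

section \<open>Generation of the Borel sets of the cube by dyadic cubes\<close>

definition dyadic_sets :: "(real ^ 'd) set set" where
  "dyadic_sets = insert {} {C. \<exists>k. dyadic_cube k C}"

lemma Int_stable_dyadic_sets: "Int_stable dyadic_sets"
proof (rule Int_stableI)
  fix A B :: "(real ^ 'd) set"
  assume AB: "A \<in> dyadic_sets" "B \<in> dyadic_sets"
  show "A \<inter> B \<in> dyadic_sets"
  proof (cases "A \<inter> B = {}")
    case False
    then obtain z where z: "z \<in> A \<inter> B"
      by auto
    obtain k x l y where "x \<in> unit_cube" "A = dyadic_cell k x" "B = dyadic_cell l y"
      using AB z by (auto simp: dyadic_sets_def dyadic_cube_iff)
    moreover from this z have "z \<in> unit_cube"
      by (auto simp: dyadic_cell_def)
    ultimately show ?thesis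
      using z dyadic_cell_Int[of x z k l y] by (auto simp: dyadic_sets_def dyadic_cube_iff)
  qed (simp add: dyadic_sets_def)
qed

text \<open>A cube is given by its level and one natural number for each of finitely many
  coordinates. Consequently every union of dyadic sets is a countable union.\<close>

lemma countable_dyadic_sets: "countable (dyadic_sets :: (real ^ 'd) set set)"
proof (rule countable_subset)
  show "(dyadic_sets :: (real ^ 'd) set set) \<subseteq>
    insert {} (range (\<lambda>(k, j). {x. \<forall>i. x $ i \<in> dyadic_interval k (j i)}))"
    by (auto simp: dyadic_sets_def dyadic_cube_def)
qed simp

lemma dyadic_interval_subset: "dyadic_interval k j \<subseteq> {real j / 2 ^ k .. real (j + 1) / 2 ^ k}"
proof (cases "j + 1 = 2 ^ k")
  case True
  then have "real (j + 1) / 2 ^ k = 1"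
    by simp
  with True show ?thesis
    by (simp add: dyadic_interval_def)
qed (auto simp: dyadic_interval_def)

lemma dyadic_cube_sets_borel:
  assumes "dyadic_cube k C"
  shows "C \<in> sets borel"
proof -
  obtain j where C: "C = {x. \<forall>i. x $ i \<in> dyadic_interval k (j i)}"
    using assms by (auto simp: dyadic_cube_def)
  have "dyadic_interval k (j i) \<in> sets borel" for i
    by (simp add: dyadic_interval_def)
  then have "(\<lambda>x. x $ i) -` dyadic_interval k (j i) \<in> sets borel" for i
    by (intro measurable_sets_borel[OF borel_measurable_continuous_onI]) (auto intro!: continuous_intros)
  then have "(\<Inter>i. (\<lambda>x. x $ i) -` dyadic_interval k (j i)) \<in> sets borel"
    by (intro sets.finite_INT) auto
  also have "(\<Inter>i. (\<lambda>x. x $ i) -` dyadic_interval k (j i)) = C"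
    by (auto simp: C)
  finally show ?thesis .
qed

text \<open>Comparison with the sum norm gives the factor \<open>CARD('d)\<close>. This crude
  constant suffices because the bound only has to tend to 0 as \<open>k\<close> grows.\<close>

lemma dist_dyadic_cell_le:
  assumes "(x :: real ^ 'd) \<in> unit_cube" "y \<in> dyadic_cell k x"
  shows "dist x y \<le> real CARD('d) / 2 ^ k"
proof -
  have "\<bar>x $ i - y $ i\<bar> \<le> 1 / 2 ^ k" for i
  proof -
    have "x \<in> dyadic_cell k x"
      using assms by (simp add: dyadic_cell_def)
    with assms have "{x $ i, y $ i} \<subseteq> dyadic_interval k (dyadic_index k (x $ i))"
      by (auto simp: dyadic_cell_altdef)
    also have "\<dots> \<subseteq> {real (dyadic_index k (x $ i)) / 2 ^ k .. real (dyadic_index k (x $ i) + 1) / 2 ^ k}"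
      by (rule dyadic_interval_subset)
    finally show ?thesis
      by (auto simp: add_divide_distrib abs_le_iff)
  qed
  then have "(\<Sum>i\<in>UNIV. \<bar>(x - y) $ i\<bar>) \<le> real CARD('d) * (1 / 2 ^ k)"
    by (intro sum_bounded_above) auto
  then show ?thesis
    using norm_le_l1_cart[of "x - y"] by (simp add: dist_norm)
qed

lemma open_Int_unit_cube_eq:
  fixes U :: "(real ^ 'd) set"
  assumes "open U"
  shows "unit_cube \<inter> U = \<Union>{C \<in> dyadic_sets. C \<subseteq> U}"
proof (intro equalityI subsetI)
  fix x assume x: "x \<in> unit_cube \<inter> U"
  then obtain e where e: "e > 0" "ball x e \<subseteq> U"
    using openE[OF assms, of x] by auto
  \<comment> \<open>The level is chosen so that the distance bound \<open>CARD('d) / 2 ^ k\<close>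
    for a cell falls below the radius \<open>e\<close>.\<close>
  obtain k where "(1 / 2) ^ k < e / real CARD('d)"
    using real_arch_pow_inv[of "e / real CARD('d)" "1 / 2"] e by auto
  then have k: "real CARD('d) / 2 ^ k < e"
    by (simp add: field_simps)
  have "dyadic_cell k x \<subseteq> ball x e"
  proof
    fix y assume "y \<in> dyadic_cell k x"
    then show "y \<in> ball x e"
      using dist_dyadic_cell_le[of x y k] x k by auto
  qed
  with e have "dyadic_cell k x \<subseteq> U" "x \<in> dyadic_cell k x"
    using x by (auto simp: dyadic_cell_def)
  moreover have "dyadic_cell k x \<in> dyadic_sets"
    using x by (auto simp: dyadic_sets_def dyadic_cube_iff)
  ultimately show "x \<in> \<Union>{C \<in> dyadic_sets. C \<subseteq> U}"
    by blast
next
  fix x assume "x \<in> \<Union>{C \<in> dyadic_sets. C \<subseteq> U}"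
  then show "x \<in> unit_cube \<inter> U"
    by (auto simp: dyadic_sets_def dyadic_cube_iff dyadic_cell_def)
qed

text \<open>Each family generates the other: traces of open sets are countable unions of dyadic
  sets, and dyadic sets are Borel subsets of the cube.\<close>

lemma sets_unit_cube_eq_sigma_dyadic:
  "sets (restrict_space borel unit_cube) = sigma_sets unit_cube (dyadic_sets :: (real ^ 'd) set set)"
proof -
  have restr: "sets (restrict_space borel unit_cube)
      = sigma_sets unit_cube ((\<inter>) (unit_cube :: (real ^ 'd) set) ` {U. open U})"
    by (rule sets_restrict_space_sigma[of _ UNIV]) (simp_all, simp add: borel_def)
  note restr
  also have "\<dots> = sigma_sets unit_cube dyadic_sets"
  proof (rule sigma_sets_eqI)
    fix A assume "A \<in> (\<inter>) (unit_cube :: (real ^ 'd) set) ` {U. open U}"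
    then obtain U where "open U" "A = unit_cube \<inter> U"
      by auto
    then have "A = \<Union>{C \<in> dyadic_sets. C \<subseteq> U}"
      by (simp add: open_Int_unit_cube_eq)
    also have "\<dots> \<in> sigma_sets unit_cube dyadic_sets"
      by (intro sigma_sets_UNION countable_subset[OF _ countable_dyadic_sets]) auto
    finally show "A \<in> sigma_sets unit_cube dyadic_sets" .
  next
    fix C :: "(real ^ 'd) set"
    assume C: "C \<in> dyadic_sets"
    then have "C \<in> sets borel" "C \<subseteq> unit_cube"
      by (auto simp: dyadic_sets_def dyadic_cube_sets_borel) (auto simp: dyadic_cube_iff dyadic_cell_def)
    then have "C \<in> sets (restrict_space borel unit_cube)"
      by (auto simp: sets_restrict_space)
    then show "C \<in> sigma_sets unit_cube ((\<inter>) unit_cube ` {U. open U})"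
      using restr by simp
  qed
  finally show ?thesis .
qed

section \<open>Volumes of cells and the words that address them\<close>

lemma emeasure_dyadic_cell:
  assumes "(x :: real ^ 'd) \<in> unit_cube"
  shows "emeasure lborel (dyadic_cell k x) = ennreal ((1 / 2 ^ CARD('d)) ^ k)"
proof -
  define j where "j i = dyadic_index k (x $ i)" for i
  define l u :: "real ^ 'd" where "l = (\<chi> i. real (j i) / 2 ^ k)" and "u = (\<chi> i. real (j i + 1) / 2 ^ k)"
  have j: "j i < 2 ^ k" for i
    unfolding j_def using assms by (intro dyadic_index_less) (simp only: mem_unit_cube_iff)
  have cell: "dyadic_cell k x = {y. \<forall>i. y $ i \<in> dyadic_interval k (j i)}"
    using assms by (simp add: dyadic_cell_altdef j_def)
  have meas: "dyadic_cell k x \<in> sets borel"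
    using assms dyadic_cube_sets_borel[of k] by (auto simp: dyadic_cube_iff)
  \<comment> \<open>The cell is squeezed between the open and the closed box with corners
    \<open>l\<close> and \<open>u\<close>. These have equal volume, so it does not matter which
    faces belong to the cell.\<close>
  have "dyadic_cell k x \<subseteq> cbox l u"
    using dyadic_interval_subset[of k] by (force simp: cell l_def u_def mem_box_cart)
  then have le: "emeasure lborel (dyadic_cell k x) \<le> emeasure lborel (cbox l u)"
    by (intro emeasure_mono) auto
  have "{real (j i) / 2 ^ k <..< real (j i + 1) / 2 ^ k} \<subseteq> dyadic_interval k (j i)" for i
  proof -
    have "real (j i + 1) \<le> 2 ^ k"
      using j[of i] by (metis Suc_eq_plus1 Suc_leI of_nat_le_numeral_power_cancel_iff)
    \<comment> \<open>This bound settles the last interval, whose right end is written as 1 in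
      \<open>dyadic_interval\<close>.\<close>
    then have "real (j i + 1) / 2 ^ k \<le> 1"
      by simp
    then have "y \<le> 1" if "y < real (j i + 1) / 2 ^ k" for y
      using that by linarith
    then show ?thesis
      by (auto simp: dyadic_interval_def simp del: of_nat_add)
  qed
  then have "box l u \<subseteq> dyadic_cell k x"
    by (fastforce simp: cell l_def u_def mem_box_cart)
  then have "emeasure lborel (box l u) \<le> emeasure lborel (dyadic_cell k x)"
    by (intro emeasure_mono) (simp_all add: meas)
  with le have "emeasure lborel (dyadic_cell k x) = emeasure lborel (cbox l u)"
    by (simp add: emeasure_lborel_box_eq emeasure_lborel_cbox_eq)
  also have "\<dots> = ennreal (measure lborel (cbox l u))"
    using emeasure_lborel_cbox_finite[of l u] by (simp add: emeasure_eq_ennreal_measure less_top)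
  also have "measure lborel (cbox l u) = (\<Prod>i\<in>UNIV. u $ i - l $ i)"
  proof (rule content_cbox_cart)
    have "l \<in> cbox l u"
      by (simp add: mem_box_cart l_def u_def divide_right_mono)
    then show "cbox l u \<noteq> {}"
      by auto
  qed
  also have "\<dots> = (1 / 2 ^ k) ^ CARD('d)"
    by (simp add: l_def u_def add_divide_distrib)
  also have "\<dots> = (1 / 2 ^ CARD('d)) ^ k"
    by (simp add: power_divide mult.commute flip: power_mult)
  finally show ?thesis .
qed

text \<open>Induction on the level: the next cell around \<open>x\<close> lies inside the cube
  \<open>Q w\<close> already reached, so it is one of the numbered children, and its number is
  appended to \<open>w\<close>.\<close>

lemma dyadic_indexing_surj:
  fixes Q :: "nat list \<Rightarrow> (real ^ 'd) set"
  assumes "dyadic_indexing Q" "x \<in> unit_cube"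
  shows "\<exists>w \<in> words (2 ^ CARD('d)). length w = k \<and> Q w = dyadic_cell k x"
proof (induction k)
  case 0
  then show ?case
    using assms by (auto simp: dyadic_indexing_def dyadic_cell_0 words_def)
next
  case (Suc k)
  then obtain w where w: "w \<in> words (2 ^ CARD('d))" "length w = k" "Q w = dyadic_cell k x"
    by auto
  have "dyadic_cell (Suc k) x \<subseteq> Q w"
    unfolding w(3) by (intro dyadic_cell_antimono assms) simp
  then have "dyadic_cell (Suc k) x \<in> {C. dyadic_cube (Suc (length w)) C \<and> C \<subseteq> Q w}"
    using assms(2) w(2) by (auto simp: dyadic_cube_iff)
  also have "\<dots> = (\<lambda>i. Q (w @ [i])) ` {1 .. 2 ^ CARD('d)}"
    using assms(1) w(1) by (auto simp: dyadic_indexing_def bij_betw_def)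
  finally obtain i where "i \<in> {1 .. 2 ^ CARD('d)}" "Q (w @ [i]) = dyadic_cell (Suc k) x"
    by auto
  with w show ?case
    by (intro bexI[of _ "w @ [i]"]) (auto simp: words_def)
qed

subsection \<open>The intensity of the cascade\<close>

text \<open>Both facts are read off from \<open>uniform_simplex\<close>, the distribution of
  \<open>X v\<close>, by change of variables.\<close>

lemma cascade_weight:
  assumes "dyadic_cascade M (Q :: nat list \<Rightarrow> (real ^ 'd) set) X \<mu>"
    and "v \<in> words (2 ^ CARD('d))" "i \<in> {1 .. 2 ^ CARD('d)}"
  shows "AE s in M. 0 \<le> X v s i"
    and "(\<integral>\<^sup>+s. ennreal (X v s i) \<partial>M) = ennreal (1 / 2 ^ CARD('d))"
proof -
  let ?B = "\<Pi>\<^sub>M i\<in>{1 .. 2 ^ CARD('d)}. (borel :: real measure)"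
  have "prob_space.indep_vars M (\<lambda>_. ?B) X (words (2 ^ CARD('d)))" "prob_space M"
    and d: "distr M ?B (X v) = uniform_simplex (2 ^ CARD('d))"
    using assms(1,2) by (auto simp: dyadic_cascade_def)
  then have X: "X v \<in> M \<rightarrow>\<^sub>M ?B"
    using assms(2) by (auto simp: prob_space.indep_vars_def)
  have coord: "(\<lambda>x. x i) \<in> ?B \<rightarrow>\<^sub>M borel"
    using assms(3) by (rule measurable_component_singleton)
  have "{x \<in> space ?B. 0 \<le> x i} \<in> sets ?B"
    using borel_measurable_le[OF borel_measurable_const coord, of 0] .
  from AE_distr_iff[OF X this] show "AE s in M. 0 \<le> X v s i"
    using AE_uniform_simplex_nonneg[OF assms(3)] unfolding d by blast
  have "(\<lambda>x. ennreal (x i)) \<in> ?B \<rightarrow>\<^sub>M borel"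
    using coord by (rule measurable_compose) simp
  then have "(\<integral>\<^sup>+x. ennreal (x i) \<partial>distr M ?B (X v)) = (\<integral>\<^sup>+s. ennreal (X v s i) \<partial>M)"
    by (intro nn_integral_distr X) simp
  then show "(\<integral>\<^sup>+s. ennreal (X v s i) \<partial>M) = ennreal (1 / 2 ^ CARD('d))"
    unfolding d by (simp add: nn_integral_uniform_simplex_coord[OF assms(3)])
qed

lemma take_in_words: "w \<in> words n \<Longrightarrow> take j w \<in> words n"
  by (auto simp: words_def dest: in_set_takeD)

lemma nth_in_words: "w \<in> words n \<Longrightarrow> j < length w \<Longrightarrow> w ! j \<in> {1..n}"
  using nth_mem[of j w] by (auto simp: words_def simp del: nth_mem)

text \<open>The mass of \<open>Q w\<close> is almost surely a product of one coordinate from each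
  vector attached to a proper prefix of \<open>w\<close>. These vectors are independent, so the
  expectation factors into means \<open>1 / n\<close> with \<open>n = 2 ^ CARD('d)\<close>.\<close>

lemma cascade_nn_integral_word:
  assumes casc: "dyadic_cascade M (Q :: nat list \<Rightarrow> (real ^ 'd) set) X \<mu>"
    and w: "w \<in> words (2 ^ CARD('d))"
  shows "(\<integral>\<^sup>+s. emeasure (\<mu> s) (Q w) \<partial>M) = ennreal ((1 / 2 ^ CARD('d)) ^ length w)"
proof -
  interpret prob_space M
    using casc by (simp add: dyadic_cascade_def)
  define k where "k = length w"
  \<comment> \<open>Prefixes of different lengths are different words, so no vector occurs twice and
    the product over positions can be reindexed by words.\<close>
  have inj: "inj_on (\<lambda>j. take j w) {..<k}"
    by (auto simp: inj_on_def k_def dest!: arg_cong[where f = length])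
  let ?I = "(\<lambda>j. take j w) ` {..<k}"
  \<comment> \<open>Independence is indexed by words, so the position must be recovered from the
    prefix: \<open>length v\<close> is \<open>j\<close> when \<open>v = take j w\<close> with
    \<open>j < k\<close>.\<close>
  let ?Y = "\<lambda>v x. ennreal (x (w ! length v))"
  have "indep_vars (\<lambda>_. \<Pi>\<^sub>M i\<in>{1 .. 2 ^ CARD('d)}. borel) X (words (2 ^ CARD('d)))"
    using casc by (simp add: dyadic_cascade_def)
  moreover have "?I \<subseteq> words (2 ^ CARD('d))"
    using take_in_words[OF w] by blast
  ultimately have "indep_vars (\<lambda>_. \<Pi>\<^sub>M i\<in>{1 .. 2 ^ CARD('d)}. borel) X ?I"
    by (rule indep_vars_subset)
  then have ind: "indep_vars (\<lambda>_. borel) (\<lambda>v s. ?Y v (X v s)) ?I"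
  proof (rule indep_vars_compose2)
    fix v assume "v \<in> ?I"
    then have "w ! length v \<in> {1 .. 2 ^ CARD('d)}"
      using nth_in_words[OF w] by (auto simp: k_def simp del: atLeastAtMost_iff)
    then have "(\<lambda>x. x (w ! length v)) \<in> (\<Pi>\<^sub>M i\<in>{1 .. 2 ^ CARD('d)}. (borel :: real measure)) \<rightarrow>\<^sub>M borel"
      by (rule measurable_component_singleton)
    then show "?Y v \<in> (\<Pi>\<^sub>M i\<in>{1 .. 2 ^ CARD('d)}. borel) \<rightarrow>\<^sub>M borel"
      by (rule measurable_compose) simp
  qed
  have nonneg: "AE s in M. \<forall>j\<in>{..<k}. 0 \<le> X (take j w) s (w ! j)"
    using cascade_weight(1)[OF casc take_in_words[OF w] nth_in_words[OF w]]
    by (intro AE_finite_allI) (simp_all add: k_def)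
  have meas: "AE s in M. measure (\<mu> s) (Q w) = (\<Prod>j<k. X (take j w) s (w ! j))"
  proof -
    have "AE s in M. \<forall>w \<in> words (2 ^ CARD('d)).
        measure (\<mu> s) (Q w) = (\<Prod>j<length w. X (take j w) s (w ! j))"
      using casc by (simp add: dyadic_cascade_def)
    then show ?thesis
      by (rule eventually_mono) (simp add: k_def w)
  qed
  have "emeasure (\<mu> s) A = ennreal (measure (\<mu> s) A)" if "s \<in> space M" for s A
    using casc that measurable_space[of \<mu> M weak_star_borel s]
    by (simp add: dyadic_cascade_def emeasure_eq_measure_weak_star)
  then have "(\<integral>\<^sup>+s. emeasure (\<mu> s) (Q w) \<partial>M) = (\<integral>\<^sup>+s. ennreal (measure (\<mu> s) (Q w)) \<partial>M)"
    by (intro nn_integral_cong) simp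
  also have "\<dots> = (\<integral>\<^sup>+s. (\<Prod>j<k. ennreal (X (take j w) s (w ! j))) \<partial>M)"
  proof (rule nn_integral_cong_AE)
    show "AE s in M. ennreal (measure (\<mu> s) (Q w)) = (\<Prod>j<k. ennreal (X (take j w) s (w ! j)))"
      \<comment> \<open>Nonnegativity of the weights is what allows \<open>ennreal\<close> to pass
        inside the product.\<close>
      using nonneg meas by eventually_elim (subst prod_ennreal, auto)
  qed
  also have "\<dots> = (\<integral>\<^sup>+s. (\<Prod>v\<in>?I. ?Y v (X v s)) \<partial>M)"
    unfolding prod.reindex[OF inj] by (auto simp: k_def intro!: nn_integral_cong prod.cong)
  also have "\<dots> = (\<Prod>v\<in>?I. \<integral>\<^sup>+s. ?Y v (X v s) \<partial>M)"
    using ind by (intro indep_vars_nn_integral) auto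
  also have "\<dots> = (\<Prod>j<k. \<integral>\<^sup>+s. ennreal (X (take j w) s (w ! j)) \<partial>M)"
    unfolding prod.reindex[OF inj] by (auto simp: k_def intro!: nn_integral_cong prod.cong)
  also have "\<dots> = (\<Prod>j<k. ennreal (1 / 2 ^ CARD('d)))"
    using cascade_weight(2)[OF casc take_in_words[OF w] nth_in_words[OF w]]
    by (intro prod.cong) (auto simp: k_def)
  also have "\<dots> = ennreal ((1 / 2 ^ CARD('d)) ^ k)"
    by (simp add: ennreal_power)
  finally show ?thesis
    by (simp add: k_def)
qed

text \<open>The bind is the intensity measure. It agrees with Lebesgue measure on cells, and these
  together with the empty set form an intersection-stable generator, so uniqueness of measures
  applies.\<close>

lemma cascade_bind_eq:
  fixes \<mu> :: "'a \<Rightarrow> (real ^ 'd) measure"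
  assumes casc: "dyadic_cascade M Q X \<mu>"
  shows "M \<bind> \<mu> = restrict_space lborel unit_cube"
proof -
  let ?R = "restrict_space borel (unit_cube :: (real ^ 'd) set)"
  interpret prob_space M
    using casc by (simp add: dyadic_cascade_def)
  have \<mu>: "\<mu> \<in> M \<rightarrow>\<^sub>M subprob_algebra ?R"
    using measurable_compose[OF _ id_measurable_weak_star_borel, of \<mu> M] casc
    by (intro measurable_prob_algebraD) (simp add: dyadic_cascade_def)
  note em = emeasure_bind[OF not_empty \<mu>]
  have cell: "emeasure (M \<bind> \<mu>) (dyadic_cell k x)
      = emeasure (restrict_space lborel unit_cube) (dyadic_cell k x)"
    if x: "x \<in> unit_cube" for k x
  proof -
    have c: "dyadic_cell k x \<in> sets borel" "dyadic_cell k x \<subseteq> unit_cube"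
      using x dyadic_cube_sets_borel[of k] by (auto simp: dyadic_cube_iff) (auto simp: dyadic_cell_def)
    then have "dyadic_cell k x \<in> sets ?R"
      by (auto simp: sets_restrict_space)
    then have "emeasure (M \<bind> \<mu>) (dyadic_cell k x) = (\<integral>\<^sup>+s. emeasure (\<mu> s) (dyadic_cell k x) \<partial>M)"
      by (rule em)
    also obtain w where "w \<in> words (2 ^ CARD('d))" "length w = k" "Q w = dyadic_cell k x"
      using dyadic_indexing_surj[OF _ x] casc unfolding dyadic_cascade_def by blast
    then have "(\<integral>\<^sup>+s. emeasure (\<mu> s) (dyadic_cell k x) \<partial>M) = ennreal ((1 / 2 ^ CARD('d)) ^ k)"
      using cascade_nn_integral_word[OF casc] by metis
    also have "\<dots> = emeasure lborel (dyadic_cell k x)"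
      using x by (simp add: emeasure_dyadic_cell)
    also have "\<dots> = emeasure (restrict_space lborel unit_cube) (dyadic_cell k x)"
      using c by (simp add: emeasure_restrict_space)
    finally show ?thesis .
  qed
  have unit: "unit_cube \<in> (dyadic_sets :: (real ^ 'd) set set)" "emeasure (M \<bind> \<mu>) unit_cube \<noteq> \<infinity>"
  proof -
    have "(0 :: real ^ 'd) \<in> unit_cube"
      by (simp add: mem_box_cart)
    from dyadic_cell_0[OF this] cell[OF this, of 0] this
    show "unit_cube \<in> (dyadic_sets :: (real ^ 'd) set set)" "emeasure (M \<bind> \<mu>) unit_cube \<noteq> \<infinity>"
      using emeasure_lborel_cbox_finite[of "0 :: real ^ 'd" 1]
      by (auto simp: dyadic_sets_def dyadic_cube_iff emeasure_restrict_space)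
  qed
  show ?thesis
  \<comment> \<open>The cube is itself the cell of level 0 and has finite intensity, so the constant
    sequence serves as the exhausting sequence.\<close>
  proof (rule measure_eqI_generator_eq[OF Int_stable_dyadic_sets, of unit_cube _ _ "\<lambda>_. unit_cube"])
    show "dyadic_sets \<subseteq> Pow (unit_cube :: (real ^ 'd) set)"
      by (auto simp: dyadic_sets_def dyadic_cube_iff dyadic_cell_def)
    show "sets (M \<bind> \<mu>) = sigma_sets unit_cube dyadic_sets"
      using sets_bind[OF sets_kernel[OF \<mu>] not_empty] by (simp add: sets_unit_cube_eq_sigma_dyadic)
    show "sets (restrict_space lborel (unit_cube :: (real ^ 'd) set)) = sigma_sets unit_cube dyadic_sets"
      by (simp add: sets_restrict_space flip: sets_unit_cube_eq_sigma_dyadic)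
    fix C :: "(real ^ 'd) set"
    assume "C \<in> dyadic_sets"
    then show "emeasure (M \<bind> \<mu>) C = emeasure (restrict_space lborel unit_cube) C"
      using cell by (auto simp: dyadic_sets_def dyadic_cube_iff)
  qed (use unit in auto)
qed

theorem lemma3p2:
  fixes M :: "'a measure" and Q :: "nat list \<Rightarrow> (real ^ 'd) set"
    and X :: "nat list \<Rightarrow> 'a \<Rightarrow> nat \<Rightarrow> real" and \<mu>\<^sub>0 :: "'a \<Rightarrow> (real ^ 'd) measure"
    and \<P> :: "(real ^ 'd) measure measure"
    and N :: "'b measure" and \<mu> :: "'b \<Rightarrow> (real ^ 'd) measure"
    and E :: "(real ^ 'd) set"
  assumes "dyadic_cascade M Q X \<mu>\<^sub>0"
    and "\<P> = distr M weak_star_borel \<mu>\<^sub>0"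
    and "prob_space N"
    and "\<mu> \<in> measurable N weak_star_borel"
    and "distr N weak_star_borel \<mu> = \<P>"
    and "E \<in> sets borel" and "E \<subseteq> unit_cube"
  shows "integrable N (\<lambda>s. measure (\<mu> s) E) \<and>
    (LINT s|N. measure (\<mu> s) E) = measure lborel E"
proof -
  let ?R = "restrict_space borel (unit_cube :: (real ^ 'd) set)"
  interpret M: prob_space M
    using assms(1) by (simp add: dyadic_cascade_def)
  interpret N: prob_space N
    by fact
  have \<mu>\<^sub>0: "\<mu>\<^sub>0 \<in> M \<rightarrow>\<^sub>M weak_star_borel"
    using assms(1) by (simp add: dyadic_cascade_def)
  have E: "E \<in> sets ?R"
    using assms(6,7) by (auto simp: sets_restrict_space)
  have id: "(\<lambda>\<nu>. \<nu>) \<in> weak_star_borel \<rightarrow>\<^sub>M prob_algebra ?R"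
    using id_measurable_weak_star_borel by (simp add: id_def)
  have em: "(\<lambda>\<nu>. emeasure \<nu> E) \<in> borel_measurable weak_star_borel"
    by (rule measurable_compose[OF measurable_prob_algebraD[OF id] measurable_emeasure_subprob_algebra[OF E]])
  have m: "(\<lambda>s. measure (\<mu> s) E) \<in> borel_measurable N"
    using measurable_compose[OF measurable_compose[OF assms(4) id] measurable_measure_prob_algebra[OF E]] .
  have emeasure_eq: "emeasure (\<mu> s) E = ennreal (measure (\<mu> s) E)" if "s \<in> space N" for s
    by (rule emeasure_eq_measure_weak_star[OF measurable_space[OF assms(4) that]])
  \<comment> \<open>Finiteness is needed to return to real numbers, because \<open>measure\<close>
    takes the value 0 on sets of infinite measure.\<close>
  have fin: "emeasure lborel E \<noteq> \<infinity>"
    using emeasure_mono[OF assms(7), of lborel] emeasure_lborel_cbox_finite[of "0 :: real ^ 'd" 1]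
    by (auto simp: top_unique)
  have "(\<integral>\<^sup>+s. ennreal (measure (\<mu> s) E) \<partial>N) = (\<integral>\<^sup>+s. emeasure (\<mu> s) E \<partial>N)"
    by (intro nn_integral_cong) (simp add: emeasure_eq)
  \<comment> \<open>The expectation depends only on the law, so it is carried from \<open>N\<close>
    to \<open>\<P>\<close> and from there to the cascade on \<open>M\<close>, where it is the
    intensity of \<open>E\<close>.\<close>
  also have "\<dots> = (\<integral>\<^sup>+\<nu>. emeasure \<nu> E \<partial>distr N weak_star_borel \<mu>)"
    by (rule nn_integral_distr[symmetric]) (simp_all add: assms(4) em)
  also have "\<dots> = (\<integral>\<^sup>+s. emeasure (\<mu>\<^sub>0 s) E \<partial>M)"
    unfolding assms(2,5) by (rule nn_integral_distr) (simp_all add: \<mu>\<^sub>0 em)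
  also have "\<dots> = emeasure (M \<bind> \<mu>\<^sub>0) E"
    by (rule emeasure_bind[OF M.not_empty measurable_prob_algebraD[OF measurable_compose[OF \<mu>\<^sub>0 id]] E, symmetric])
  also have "\<dots> = emeasure lborel E"
    using assms(6,7) by (simp add: cascade_bind_eq[OF assms(1)] emeasure_restrict_space)
  also have "\<dots> = ennreal (measure lborel E)"
    using fin by (simp add: emeasure_eq_ennreal_measure)
  finally have "(\<integral>\<^sup>+s. ennreal (measure (\<mu> s) E) \<partial>N) = ennreal (measure lborel E)" .
  \<comment> \<open>For a nonnegative measurable function a finite value of the nonnegative integral
    yields integrability and the real integral at once.\<close>
  then have "has_bochner_integral N (\<lambda>s. measure (\<mu> s) E) (measure lborel E)"
    by (intro has_bochner_integral_nn_integral m) auto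
  then show ?thesis
    by (simp add: has_bochner_integral_iff)
qed

end
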